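(* Let $n\ge 2$, let $\theta_1,\dots,\theta_n>0$, and let $H$ be the quadratic operator $H(x)=x'$ with $$x_k'=\frac{\theta_k x_k}{2}\Big(x_k+2\sum_{i\ne k}x_i\Big),\qquad k=1,\dots,n.$$ Let $J(x)$ be the Jacobian matrix of $H$ at $x$, and let $\overline{E}=(\overline{x}_1,\dots,\overline{x}_n)$ be the fixed point of $H$ with coordinates $$\overline{x}_i=\frac{4\theta_i\sum_{1\le i_1<\dots<i_{n-2}\le n,\ i_j\ne i}\theta_{i_1}\cdots\theta_{i_{n-2}}-(4n-6)\prod_{j\ne i}\theta_j}{(2n-1)\prod_{j=1}^n\theta_j}.$$ Then $2$ is an eigenvalue of $J(\overline{E})$.
   Context: $H$ is a polynomial map, regarded as defined on all of $\mathbb{R}^n$ for the purpose of computing the Jacobian. For $n=2$ the sum over an empty list of indices consists of the single empty product, equal to $1$. *)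

theory Defs
  imports "HOL-Analysis.Analysis"
begin

definition quad_op :: "real ^ 'n \<Rightarrow> real ^ 'n \<Rightarrow> real ^ 'n" where
  "quad_op \<theta> x = (\<chi> k. \<theta> $ k * x $ k / 2 * (x $ k + 2 * (\<Sum>i\<in>UNIV - {k}. x $ i)))"

(* The sum over strictly increasing index tuples i_1 < ... < i_(n-2) avoiding i is a sum over
   (n-2)-element subsets A of the index type not containing i; for n = 2 only A = {} occurs. *)
definition fixed_pt :: "real ^ 'n \<Rightarrow> real ^ 'n" where
  "fixed_pt \<theta> = (\<chi> i.
     (4 * \<theta> $ i * (\<Sum>A | A \<subseteq> UNIV - {i} \<and> card A = CARD('n) - 2. \<Prod>j\<in>A. \<theta> $ j)
        - (4 * real CARD('n) - 6) * (\<Prod>j\<in>UNIV - {i}. \<theta> $ j))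
     / ((2 * real CARD('n) - 1) * (\<Prod>j\<in>UNIV. \<theta> $ j)))"

definition is_eigenvalue :: "real ^ 'n ^ 'n \<Rightarrow> real \<Rightarrow> bool" where
  "is_eigenvalue A c \<longleftrightarrow> (\<exists>v. v \<noteq> 0 \<and> A *v v = c *\<^sub>R v)"

(* quad_op is differentiable everywhere, so its library jacobian is never a junk value. *)
lemma quad_op_differentiable: "quad_op \<theta> differentiable (at x)"
proof -
  have nth: "((\<lambda>x. x $ i) has_derivative (\<lambda>h. h $ i)) (at x)" for i
    by (rule bounded_linear.has_derivative[OF bounded_linear_vec_nth has_derivative_ident])
  have "((\<lambda>x. quad_op \<theta> x) has_derivative
      (\<lambda>h. \<chi> k. \<theta> $ k * h $ k / 2 * (x $ k + 2 * (\<Sum>i\<in>UNIV - {k}. x $ i))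
              + \<theta> $ k * x $ k / 2 * (h $ k + 2 * (\<Sum>i\<in>UNIV - {k}. h $ i)))) (at x)"
    unfolding quad_op_def
    by (rule has_derivative_componentwise_within[THEN iffD2])
       (auto simp: Basis_vec_def inner_axis field_simps intro!: derivative_eq_intros nth)
  then show ?thesis
    unfolding differentiable_def by blast
qed

lemma sum_prod_co_two:
  fixes \<theta> :: "real ^ 'n"
  assumes n: "CARD('n) \<ge> 2" and pos: "\<And>i. \<theta> $ i > 0"
  shows "\<theta> $ i * (\<Sum>A | A \<subseteq> UNIV - {i} \<and> card A = CARD('n) - 2. \<Prod>j\<in>A. \<theta> $ j)
           = (\<Prod>j\<in>UNIV. \<theta> $ j) * (\<Sum>j\<in>UNIV - {i}. 1 / \<theta> $ j)"
proof -
  have nz: "\<theta> $ j \<noteq> 0" for j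
    using pos[of j] by simp
  have "{A. A \<subseteq> UNIV - {i} \<and> card A = CARD('n) - 2} = (\<lambda>j. UNIV - {i, j}) ` (UNIV - {i})"
  proof (intro equalityI subsetI)
    fix A assume A: "A \<in> {A. A \<subseteq> UNIV - {i} \<and> card A = CARD('n) - 2}"
    then have "card (UNIV - {i} - A) = 1"
      using n by (simp add: card_Diff_subset card_Diff_singleton)
    then obtain j where "UNIV - {i} - A = {j}"
      by (auto simp: card_1_singleton_iff)
    then have "A = UNIV - {i, j}" "j \<noteq> i"
      using A by auto
    then show "A \<in> (\<lambda>j. UNIV - {i, j}) ` (UNIV - {i})"
      by blast
  qed (auto simp: card_Diff_subset)
  moreover have "inj_on (\<lambda>j. UNIV - {i, j}) (UNIV - {i})"
    by (rule inj_onI) blast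
  ultimately have "(\<Sum>A | A \<subseteq> UNIV - {i} \<and> card A = CARD('n) - 2. \<Prod>j\<in>A. \<theta> $ j)
      = (\<Sum>j\<in>UNIV - {i}. \<Prod>l\<in>UNIV - {i, j}. \<theta> $ l)"
    by (simp add: sum.reindex)
  moreover have "\<theta> $ i * (\<Prod>l\<in>UNIV - {i, j}. \<theta> $ l) = (\<Prod>l\<in>UNIV. \<theta> $ l) * (1 / \<theta> $ j)"
    if "j \<in> UNIV - {i}" for j
  proof -
    have "(\<Prod>l\<in>UNIV. \<theta> $ l) = \<theta> $ i * (\<Prod>l\<in>UNIV - {i}. \<theta> $ l)"
      by (simp add: prod.remove)
    also have "(\<Prod>l\<in>UNIV - {i}. \<theta> $ l) = \<theta> $ j * (\<Prod>l\<in>UNIV - {i} - {j}. \<theta> $ l)"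
      using that by (intro prod.remove) auto
    also have "UNIV - {i} - {j} = UNIV - {i, j}"
      by blast
    finally show ?thesis
      using nz[of j] by simp
  qed
  ultimately show ?thesis
    by (simp add: sum_distrib_left)
qed

(* The coordinates above do define a fixed point. *)
lemma quad_op_fixed_pt:
  fixes \<theta> :: "real ^ 'n"
  assumes n: "CARD('n) \<ge> 2" and pos: "\<And>i. \<theta> $ i > 0"
  shows "quad_op \<theta> (fixed_pt \<theta>) = fixed_pt \<theta>"
proof -
  define N where "N = real CARD('n)"
  define s where "s = (\<Sum>j\<in>UNIV. 1 / \<theta> $ j)"
  define P where "P = (\<Prod>j\<in>UNIV. \<theta> $ j)"
  have nz: "\<theta> $ j \<noteq> 0" for j
    using pos[of j] by simp
  have P: "P \<noteq> 0"
    unfolding P_def using nz by simp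
  have N: "2 * N - 1 > 0"
    using n unfolding N_def by simp
  have x: "fixed_pt \<theta> $ i = 4 * s / (2 * N - 1) - 2 / \<theta> $ i" for i
  proof -
    have "P = \<theta> $ i * (\<Prod>j\<in>UNIV - {i}. \<theta> $ j)"
      unfolding P_def by (simp add: prod.remove)
    then have a: "(\<Prod>j\<in>UNIV - {i}. \<theta> $ j) = P * (1 / \<theta> $ i)"
      using nz[of i] by simp
    have b: "(\<Sum>j\<in>UNIV - {i}. 1 / \<theta> $ j) = s - 1 / \<theta> $ i"
      unfolding s_def by (simp add: sum_diff1)
    have "fixed_pt \<theta> $ i = (4 * (P * (s - 1 / \<theta> $ i)) - (4 * N - 6) * (P * (1 / \<theta> $ i)))
                            / ((2 * N - 1) * P)"
      unfolding fixed_pt_def vec_lambda_beta mult.assoc sum_prod_co_two[OF n pos] a b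
      by (simp add: P_def N_def)
    also have "\<dots> = 4 * s / (2 * N - 1) - 2 / \<theta> $ i"
      using P N nz[of i] by (simp add: divide_simps) (simp add: algebra_simps)
    finally show ?thesis .
  qed
  have "(\<Sum>i\<in>UNIV. fixed_pt \<theta> $ i) = N * (4 * s / (2 * N - 1)) - 2 * s"
    unfolding x s_def N_def by (simp add: sum_subtractf sum_distrib_left)
  also have "\<dots> = 2 * s / (2 * N - 1)"
    using N by (simp add: divide_simps) (simp add: algebra_simps)
  finally have S: "(\<Sum>i\<in>UNIV. fixed_pt \<theta> $ i) = 2 * s / (2 * N - 1)" .
  have "quad_op \<theta> (fixed_pt \<theta>) $ k = fixed_pt \<theta> $ k" for k
  proof -
    have "(\<Sum>i\<in>UNIV - {k}. fixed_pt \<theta> $ i) = 2 * s / (2 * N - 1) - fixed_pt \<theta> $ k"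
      by (simp add: sum_diff1 S)
    then have "fixed_pt \<theta> $ k + 2 * (\<Sum>i\<in>UNIV - {k}. fixed_pt \<theta> $ i) = 2 / \<theta> $ k"
      by (simp add: x[of k])
    then show ?thesis
      unfolding quad_op_def using nz[of k] by simp
  qed
  then show ?thesis
    by (simp add: vec_eq_iff)
qed

end

(* The map H is homogeneous of degree 2 and differentiable, so Euler's identity gives
   J(x) x = 2 H(x).  At a fixed point this reads J(x) x = 2 x, hence a nonzero fixed point is
   itself an eigenvector for the eigenvalue 2. *)
theory Submission
  imports Defs
begin

text \<open>The curve \<open>t \<mapsto> f (t *\<^sub>R x)\<close> is differentiated at
  \<open>t = 1\<close> in two ways: by the chain rule, and as \<open>t\<^sup>2\<close> times a
  constant vector. Uniqueness of the derivative equates the results.\<close>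

lemma euler_homogeneous_quadratic:
  fixes f :: "real ^ 'n \<Rightarrow> real ^ 'm"
  assumes diff: "f differentiable (at x)" and hom: "\<And>t. f (t *\<^sub>R x) = t\<^sup>2 *\<^sub>R f x"
  shows "jacobian f (at x) *v x = 2 *\<^sub>R f x"
proof -
  let ?J = "jacobian f (at x)"
  \<comment> \<open>The base point is written \<open>1 *\<^sub>R x\<close> so that it matches the
    value of the inner map at \<open>t = 1\<close> in the chain rule.\<close>
  have "(f has_derivative (\<lambda>h. ?J *v h)) (at (1 *\<^sub>R x))"
    using diff by (simp add: jacobian_works)
  moreover have "((\<lambda>t::real. t *\<^sub>R x) has_derivative (\<lambda>h. h *\<^sub>R x)) (at 1)"
    by (auto intro!: derivative_eq_intros)
  ultimately have "((\<lambda>t. f (t *\<^sub>R x)) has_derivative (\<lambda>h. ?J *v (h *\<^sub>R x))) (at 1)"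
    by (rule has_derivative_compose[rotated])
  moreover have "((\<lambda>t::real. f (t *\<^sub>R x)) has_derivative (\<lambda>h. (2 * h) *\<^sub>R f x)) (at 1)"
    unfolding hom by (auto intro!: derivative_eq_intros)
  ultimately have "(\<lambda>h. ?J *v (h *\<^sub>R x)) = (\<lambda>h. (2 * h) *\<^sub>R f x)"
    by (rule has_derivative_unique)
  from fun_cong[OF this, of 1] show ?thesis
    by simp
qed

lemma quad_op_scaleR: "quad_op \<theta> (t *\<^sub>R x) = t\<^sup>2 *\<^sub>R quad_op \<theta> x"
  by (simp add: quad_op_def vec_eq_iff sum_distrib_left[symmetric] power2_eq_square algebra_simps)

text \<open>An eigenvector must be nonzero. If all coordinates vanished, every
  \<open>1 / \<theta> $ i\<close> would be the same multiple of the sum \<open>s\<close> of all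
  reciprocals, and adding these relations contradicts \<open>s > 0\<close>.\<close>

lemma fixed_pt_nonzero:
  fixes \<theta> :: "real ^ 'n"
  assumes n: "CARD('n) \<ge> 2" and pos: "\<And>i. \<theta> $ i > 0"
  shows "fixed_pt \<theta> \<noteq> 0"
proof
  assume zero: "fixed_pt \<theta> = 0"
  define N where "N = real CARD('n)"
  define s where "s = (\<Sum>j\<in>UNIV. 1 / \<theta> $ j)"
  define P where "P = (\<Prod>j\<in>UNIV. \<theta> $ j)"
  have P: "P > 0"
    unfolding P_def using pos by (simp add: prod_pos)
  have N: "2 * N - 1 > 0"
    using n unfolding N_def by simp
  \<comment> \<open>This is the vanishing numerator of coordinate \<open>i\<close> divided by
    \<open>P\<close>; the coefficient is \<open>4 * N - 6\<close> plus the 4 that comes from leaving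
    index \<open>i\<close> out of \<open>s\<close>.\<close>
  have coord: "4 * s = (4 * N - 2) * (1 / \<theta> $ i)" for i
  proof -
    have "P = \<theta> $ i * (\<Prod>j\<in>UNIV - {i}. \<theta> $ j)"
      unfolding P_def by (simp add: prod.remove)
    then have a: "(\<Prod>j\<in>UNIV - {i}. \<theta> $ j) = P * (1 / \<theta> $ i)"
      using pos[of i] by simp
    have b: "(\<Sum>j\<in>UNIV - {i}. 1 / \<theta> $ j) = s - 1 / \<theta> $ i"
      unfolding s_def by (simp add: sum_diff1)
    have "(4 * (P * (s - 1 / \<theta> $ i)) - (4 * N - 6) * (P * (1 / \<theta> $ i))) / ((2 * N - 1) * P)
        = fixed_pt \<theta> $ i"
      unfolding fixed_pt_def vec_lambda_beta mult.assoc sum_prod_co_two[OF n pos] a b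
      by (simp add: P_def N_def)
    then have "4 * (P * (s - 1 / \<theta> $ i)) - (4 * N - 6) * (P * (1 / \<theta> $ i)) = 0"
      using zero P N by simp
    \<comment> \<open>With \<open>r\<close> in place of \<open>1 / \<theta> $ i\<close> this is a
      polynomial identity, free of division.\<close>
    moreover have "4 * (P * (s - r)) - (4 * N - 6) * (P * r) = P * (4 * s - (4 * N - 2) * r)" for r
      by (simp add: algebra_simps)
    ultimately have "P * (4 * s - (4 * N - 2) * (1 / \<theta> $ i)) = 0"
      by metis
    then show ?thesis
      using P by simp
  qed
  \<comment> \<open>Summation turns the right side into a multiple of \<open>s\<close> as well; the
    two totals differ by \<open>2 * s\<close>, which forces \<open>s = 0\<close>.\<close>
  have "(\<Sum>i\<in>(UNIV :: 'n set). 4 * s) = (\<Sum>i\<in>UNIV. (4 * N - 2) * (1 / \<theta> $ i))"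
    using coord by (intro sum.cong) auto
  then have "N * (4 * s) = (4 * N - 2) * s"
    unfolding s_def sum_distrib_left[symmetric] by (simp add: N_def)
  then have "s = 0"
    by (simp add: algebra_simps)
  moreover have "s > 0"
    unfolding s_def using pos by (intro sum_pos) auto
  ultimately show False
    by simp
qed

theorem theorem8:
  fixes \<theta> :: "real ^ 'n"
  assumes "CARD('n) \<ge> 2"
    and "\<And>i. \<theta> $ i > 0"
  shows "is_eigenvalue (jacobian (quad_op \<theta>) (at (fixed_pt \<theta>))) 2"
  unfolding is_eigenvalue_def
  using fixed_pt_nonzero[OF assms] quad_op_fixed_pt[OF assms]
    euler_homogeneous_quadratic[OF quad_op_differentiable quad_op_scaleR, of \<theta> "fixed_pt \<theta>"]
  by auto

end
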